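(* Let \(K\rightarrowtail L\twoheadrightarrow P\) be an extension of complete, torsionfree bornological \(V\)-modules and assume that \(P\) is algebraically torsionfree. Then \(K'\rightarrowtail L'\twoheadrightarrow P'\) is an extension of complete bornological \(V\)-modules as well. In addition, \(L\) is nuclear if and only if both \(K\) and \(P\) are nuclear.
   Context: Let \(V\) be a complete discrete valuation ring with uniformiser \(\pi\). A bornology on a set is a collection of subsets (called bounded) containing all finite subsets and closed under finite unions and under taking subsets. A bornological \(V\)-module is a \(V\)-module with a bornology such that every bounded subset is contained in a bounded \(V\)-submodule; bounded maps send bounded sets to bounded sets. It is complete if every bounded subset is contained in a bounded, \(\pi\)-adically complete \(V\)-submodule, and torsionfree if it is torsionfree as a \(V\)-module and \(\pi^{-1}S=\{x:\pi x\in S\}\) is bounded for every bounded \(S\). An extension \(K\rightarrowtail L\twoheadrightarrow P\) is a sequence of bounded \(V\)-linear maps, exact as \(V\)-modules, in which \(K\to L\) is a bornological embedding (a subset of \(K\) is bounded iff its image in \(L\) is bounded) and \(L\to P\) is a bornological quotient map (every bounded subset of \(P\) is the image of a bounded subset of \(L\)). A subset \(S\) of \(M\) is compactoid if there is a bounded \(V\)-submodule \(T\subseteq M\) with \(S\subseteq T\) such that for every \(n\in\mathbb N\) there is a finite set \(F_n\subseteq T\) with \(S\subseteq VF_n+\pi^nT\). \(M'\) denotes \(M\) with the bornology of compactoid subsets; \(M\) is nuclear if all its bounded subsets are compactoid. *)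

theory Defs
  imports Complex_Main
begin

section \<open>Complete discrete valuation rings\<close>

text \<open>pi-adic completeness (Cauchy sequences converge) together with separatedness,
  for a submodule T of a module with scalar multiplication scale.\<close>
definition pi_adic_complete ::
  "('v::comm_ring_1 \<Rightarrow> 'm::ab_group_add \<Rightarrow> 'm) \<Rightarrow> 'v \<Rightarrow> 'm set \<Rightarrow> bool" where
  "pi_adic_complete scale \<pi> T \<longleftrightarrow>
     (\<Inter>n. scale (\<pi> ^ n) ` T) = {0} \<and>
     (\<forall>x::nat \<Rightarrow> 'm. (\<forall>n. x n \<in> T) \<longrightarrow>
        (\<forall>k. \<exists>N. \<forall>m\<ge>N. \<forall>n\<ge>N. x m - x n \<in> scale (\<pi> ^ k) ` T) \<longrightarrow>
        (\<exists>y\<in>T. \<forall>k. \<exists>N. \<forall>n\<ge>N. x n - y \<in> scale (\<pi> ^ k) ` T))"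

text \<open>V (the whole type 'v) is a discrete valuation ring with uniformiser pi.\<close>
definition dvr_uniformiser :: "'v::idom \<Rightarrow> bool" where
  "dvr_uniformiser \<pi> \<longleftrightarrow> \<pi> \<noteq> 0 \<and> \<not> (\<pi> dvd 1) \<and>
     (\<forall>a. a \<noteq> 0 \<longrightarrow> (\<exists>u n. u dvd 1 \<and> a = u * \<pi> ^ n))"

definition complete_dvr :: "'v::idom \<Rightarrow> bool" where
  "complete_dvr \<pi> \<longleftrightarrow> dvr_uniformiser \<pi> \<and> pi_adic_complete (*) \<pi> (UNIV :: 'v set)"

section \<open>Bornological modules\<close>

definition bornology :: "'m set set \<Rightarrow> bool" where
  "bornology B \<longleftrightarrow> (\<forall>S. finite S \<longrightarrow> S \<in> B) \<and>
     (\<forall>S\<in>B. \<forall>T\<in>B. S \<union> T \<in> B) \<and> (\<forall>S\<in>B. \<forall>T. T \<subseteq> S \<longrightarrow> T \<in> B)"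

definition born_module ::
  "('v::comm_ring_1 \<Rightarrow> 'm::ab_group_add \<Rightarrow> 'm) \<Rightarrow> 'm set set \<Rightarrow> bool" where
  "born_module scale B \<longleftrightarrow> module scale \<and> bornology B \<and>
     (\<forall>S\<in>B. \<exists>T\<in>B. module.subspace scale T \<and> S \<subseteq> T)"

definition bounded_map :: "'a set set \<Rightarrow> 'b set set \<Rightarrow> ('a \<Rightarrow> 'b) \<Rightarrow> bool" where
  "bounded_map B1 B2 f \<longleftrightarrow> (\<forall>S\<in>B1. f ` S \<in> B2)"

definition complete_born_module ::
  "('v::comm_ring_1 \<Rightarrow> 'm::ab_group_add \<Rightarrow> 'm) \<Rightarrow> 'v \<Rightarrow> 'm set set \<Rightarrow> bool" where
  "complete_born_module scale \<pi> B \<longleftrightarrow> born_module scale B \<and>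
     (\<forall>S\<in>B. \<exists>T\<in>B. module.subspace scale T \<and> pi_adic_complete scale \<pi> T \<and> S \<subseteq> T)"

definition alg_torsionfree :: "('v::comm_ring_1 \<Rightarrow> 'm::ab_group_add \<Rightarrow> 'm) \<Rightarrow> bool" where
  "alg_torsionfree scale \<longleftrightarrow> (\<forall>c x. c \<noteq> 0 \<longrightarrow> scale c x = 0 \<longrightarrow> x = 0)"

definition born_torsionfree ::
  "('v::comm_ring_1 \<Rightarrow> 'm::ab_group_add \<Rightarrow> 'm) \<Rightarrow> 'v \<Rightarrow> 'm set set \<Rightarrow> bool" where
  "born_torsionfree scale \<pi> B \<longleftrightarrow> alg_torsionfree scale \<and>
     (\<forall>S\<in>B. {x. scale \<pi> x \<in> S} \<in> B)"

text \<open>An extension K >-> L ->> P.\<close>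
definition born_extension ::
  "('v::comm_ring_1 \<Rightarrow> 'k::ab_group_add \<Rightarrow> 'k) \<Rightarrow> 'k set set \<Rightarrow>
   ('v \<Rightarrow> 'l::ab_group_add \<Rightarrow> 'l) \<Rightarrow> 'l set set \<Rightarrow>
   ('v \<Rightarrow> 'p::ab_group_add \<Rightarrow> 'p) \<Rightarrow> 'p set set \<Rightarrow>
   ('k \<Rightarrow> 'l) \<Rightarrow> ('l \<Rightarrow> 'p) \<Rightarrow> bool" where
  "born_extension sK BK sL BL sP BP f g \<longleftrightarrow>
     module_hom sK sL f \<and> module_hom sL sP g \<and>
     bounded_map BK BL f \<and> bounded_map BL BP g \<and>
     inj f \<and> range f = {y. g y = 0} \<and> surj g \<and>
     (\<forall>S. S \<in> BK \<longleftrightarrow> f ` S \<in> BL) \<and>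
     (\<forall>S\<in>BP. \<exists>T\<in>BL. S = g ` T)"

section \<open>Compactoid subsets and nuclearity\<close>

definition compactoid ::
  "('v::comm_ring_1 \<Rightarrow> 'm::ab_group_add \<Rightarrow> 'm) \<Rightarrow> 'v \<Rightarrow> 'm set set \<Rightarrow> 'm set \<Rightarrow> bool" where
  "compactoid scale \<pi> B S \<longleftrightarrow>
     (\<exists>T\<in>B. module.subspace scale T \<and> S \<subseteq> T \<and>
        (\<forall>n::nat. \<exists>F. finite F \<and> F \<subseteq> T \<and>
           S \<subseteq> {a + b | a b. a \<in> module.span scale F \<and> b \<in> scale (\<pi> ^ n) ` T}))"

text \<open>The compactoid bornology M' on M.\<close>
definition compactoid_born ::
  "('v::comm_ring_1 \<Rightarrow> 'm::ab_group_add \<Rightarrow> 'm) \<Rightarrow> 'v \<Rightarrow> 'm set set \<Rightarrow> 'm set set" where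
  "compactoid_born scale \<pi> B = {S. compactoid scale \<pi> B S}"

definition nuclear ::
  "('v::comm_ring_1 \<Rightarrow> 'm::ab_group_add \<Rightarrow> 'm) \<Rightarrow> 'v \<Rightarrow> 'm set set \<Rightarrow> bool" where
  "nuclear scale \<pi> B \<longleftrightarrow> (\<forall>S\<in>B. compactoid scale \<pi> B S)"

end

theory Submission
  imports Defs "HOL-Library.Set_Algebras"
begin

text \<open>
  Let T be a bounded, \<pi>-adically complete submodule containing a compactoid set S, say
  S \<subseteq> span F_n + \<pi>^n T for all n. Then T \<inter> \<Inter>_n (span F_n + \<pi>^n T) is compactoid and
  \<pi>-adically closed in T, hence complete (here torsionfreeness lets one divide by \<pi>^k);
  so the compactoid bornology is complete. Bounded linear maps preserve compactoid sets.

  The rest uses that V is a discrete valuation ring, so that submodules of finitely generated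
  modules are finitely generated, and that P is torsionfree, so that f K \<inter> \<pi>^n L = f (\<pi>^n K).
  Together they show that S \<subseteq> K is compactoid as soon as f S is. A compactoid S \<subseteq> P is lifted
  by choosing finite lifts H_n of the F_n: lifts of successive approximations of a point of S
  differ, up to \<pi>^n L, by elements of a finitely generated part of the kernel fixed in advance;
  removing these corrections leaves a \<pi>-adic Cauchy sequence whose limit is a preimage of the
  point. Finally a bounded S \<subseteq> L lies in W + f (f^-1 M), where W is a compactoid lift of g S
  and M a bounded submodule, which makes L nuclear when K and P are.
\<close>

section \<open>The \<pi>-adic filtration of a submodule\<close>

definition pi_cauchy ::
  "('v::comm_ring_1 \<Rightarrow> 'm::ab_group_add \<Rightarrow> 'm) \<Rightarrow> 'v \<Rightarrow> 'm set \<Rightarrow> (nat \<Rightarrow> 'm) \<Rightarrow> bool" where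
  "pi_cauchy scale \<pi> T x \<longleftrightarrow> (\<forall>k. \<exists>N. \<forall>m\<ge>N. \<forall>n\<ge>N. x m - x n \<in> scale (\<pi> ^ k) ` T)"

definition pi_lim ::
  "('v::comm_ring_1 \<Rightarrow> 'm::ab_group_add \<Rightarrow> 'm) \<Rightarrow> 'v \<Rightarrow> 'm set \<Rightarrow> (nat \<Rightarrow> 'm) \<Rightarrow> 'm \<Rightarrow> bool" where
  "pi_lim scale \<pi> T x y \<longleftrightarrow> (\<forall>k. \<exists>N. \<forall>n\<ge>N. x n - y \<in> scale (\<pi> ^ k) ` T)"

definition pi_closed_in ::
  "('v::comm_ring_1 \<Rightarrow> 'm::ab_group_add \<Rightarrow> 'm) \<Rightarrow> 'v \<Rightarrow> 'm set \<Rightarrow> 'm set \<Rightarrow> bool" where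
  "pi_closed_in scale \<pi> T W \<longleftrightarrow>
     (\<forall>x y. (\<forall>n. x n \<in> W) \<longrightarrow> y \<in> T \<longrightarrow> pi_lim scale \<pi> T x y \<longrightarrow> y \<in> W)"

lemma pi_adic_complete_iff:
  "pi_adic_complete scale \<pi> T \<longleftrightarrow> (\<Inter>n. scale (\<pi> ^ n) ` T) = {0} \<and>
     (\<forall>x. (\<forall>n. x n \<in> T) \<longrightarrow> pi_cauchy scale \<pi> T x \<longrightarrow> (\<exists>y\<in>T. pi_lim scale \<pi> T x y))"
  unfolding pi_adic_complete_def pi_cauchy_def pi_lim_def ..

lemma set_plus_eq_Collect: "{a + b |a b. a \<in> A \<and> b \<in> B} = A + B"
  by (auto simp: set_plus_def)

lemma pi_lim_mono: "T \<subseteq> T' \<Longrightarrow> pi_lim scale \<pi> T x y \<Longrightarrow> pi_lim scale \<pi> T' x y"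
  unfolding pi_lim_def by blast

context module
begin

lemma subspace_set_plus:
  assumes X: "subspace X" and Y: "subspace Y"
  shows "subspace (X + Y)"
proof (rule subspaceI)
  show "0 \<in> X + Y" using subspace_0[OF X] subspace_0[OF Y] set_plus_intro by fastforce
next
  fix u v assume "u \<in> X + Y" "v \<in> X + Y"
  then obtain a b c d where "a \<in> X" "b \<in> Y" "c \<in> X" "d \<in> Y" "u = a + b" "v = c + d"
    by (auto elim!: set_plus_elim)
  then have "u + v = (a + c) + (b + d)" "a + c \<in> X" "b + d \<in> Y"
    using subspace_add[OF X] subspace_add[OF Y] by (simp_all add: algebra_simps)
  then show "u + v \<in> X + Y" by (metis set_plus_intro)
next
  fix c u assume "u \<in> X + Y"
  then obtain a b where "a \<in> X" "b \<in> Y" "u = a + b" by (auto elim!: set_plus_elim)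
  then have "c *s u = c *s a + c *s b" "c *s a \<in> X" "c *s b \<in> Y"
    using subspace_scale[OF X] subspace_scale[OF Y] by (simp_all add: scale_right_distrib)
  then show "c *s u \<in> X + Y" by (metis set_plus_intro)
qed

lemma set_plus_subset_subspace: "subspace T \<Longrightarrow> X \<subseteq> T \<Longrightarrow> Y \<subseteq> T \<Longrightarrow> X + Y \<subseteq> T"
  by (auto elim!: set_plus_elim intro: subspace_add)

lemma subspace_scale_image: "subspace T \<Longrightarrow> subspace ((*s) c ` T)"
  using module_hom.subspace_image[OF module_hom_scale_self] .

lemma scale_image_subset: "subspace T \<Longrightarrow> (*s) c ` T \<subseteq> T"
  by (auto intro: subspace_scale)

lemma scale_pow_image_antimono:
  assumes T: "subspace T" and "m \<le> n"
  shows "(*s) (\<pi> ^ n) ` T \<subseteq> (*s) (\<pi> ^ m) ` T"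
proof
  fix x assume "x \<in> (*s) (\<pi> ^ n) ` T"
  then obtain t where "t \<in> T" "x = (\<pi> ^ n) *s t" by blast
  then have "x = (\<pi> ^ m) *s ((\<pi> ^ (n - m)) *s t)" "(\<pi> ^ (n - m)) *s t \<in> T"
    using \<open>m \<le> n\<close> subspace_scale[OF T] by (simp_all add: power_add[symmetric])
  then show "x \<in> (*s) (\<pi> ^ m) ` T" by blast
qed

lemma scale_pow_telescope:
  assumes T: "subspace T" and steps: "\<And>n. x (Suc n) - x n \<in> (*s) (\<pi> ^ n) ` T" and "n \<le> m"
  shows "x m - x n \<in> (*s) (\<pi> ^ n) ` T"
  using \<open>n \<le> m\<close>
proof (induction m rule: dec_induct)
  case base
  show ?case using subspace_0[OF subspace_scale_image[OF T]] by simp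
next
  case (step m)
  have "x (Suc m) - x n = (x (Suc m) - x m) + (x m - x n)" by simp
  moreover have "x (Suc m) - x m \<in> (*s) (\<pi> ^ n) ` T"
    using \<open>n \<le> m\<close> steps scale_pow_image_antimono[OF T] by blast
  ultimately show ?case using step.IH subspace_add[OF subspace_scale_image[OF T]] by metis
qed

lemma pi_cauchy_if_steps:
  assumes T: "subspace T" and step: "\<And>n. x (Suc n) - x n \<in> (*s) (\<pi> ^ n) ` T"
  shows "pi_cauchy (*s) \<pi> T x"
  unfolding pi_cauchy_def
proof (intro allI exI impI)
  fix k m n :: nat assume "k \<le> m" "k \<le> n"
  then have "x m - x k \<in> (*s) (\<pi> ^ k) ` T" "x n - x k \<in> (*s) (\<pi> ^ k) ` T"
    using scale_pow_telescope[OF T step] by auto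
  moreover have "x m - x n = (x m - x k) - (x n - x k)" by simp
  ultimately show "x m - x n \<in> (*s) (\<pi> ^ k) ` T"
    using subspace_diff[OF subspace_scale_image[OF T]] by metis
qed

lemma pi_lim_if_diff_scale_pow:
  assumes T: "subspace T" and "\<And>n. x n - y \<in> (*s) (\<pi> ^ n) ` T"
  shows "pi_lim (*s) \<pi> T x y"
  unfolding pi_lim_def using assms scale_pow_image_antimono[OF T] by blast

lemma pi_lim_scale:
  assumes T: "subspace T" and lim: "pi_lim (*s) \<pi> T x y"
  shows "pi_lim (*s) \<pi> T (\<lambda>n. c *s x n) (c *s y)"
  unfolding pi_lim_def
proof
  fix k
  obtain N where "\<forall>n\<ge>N. x n - y \<in> (*s) (\<pi> ^ k) ` T" using lim unfolding pi_lim_def by blast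
  then have "\<forall>n\<ge>N. c *s (x n - y) \<in> (*s) (\<pi> ^ k) ` T"
    using subspace_scale[OF subspace_scale_image[OF T]] by blast
  then show "\<exists>N. \<forall>n\<ge>N. c *s x n - c *s y \<in> (*s) (\<pi> ^ k) ` T"
    by (auto simp: scale_right_diff_distrib)
qed

lemma pi_adic_complete_separated:
  assumes "pi_adic_complete (*s) \<pi> T" and "\<And>r. z \<in> (*s) (\<pi> ^ r) ` T"
  shows "z = 0"
proof -
  have "z \<in> (\<Inter>r. (*s) (\<pi> ^ r) ` T)" using assms(2) by blast
  then show ?thesis using assms(1) unfolding pi_adic_complete_iff by simp
qed

lemma pi_adic_completeD:
  assumes "pi_adic_complete (*s) \<pi> T" and "\<And>n. x n \<in> T" and "pi_cauchy (*s) \<pi> T x"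
  shows "\<exists>y\<in>T. pi_lim (*s) \<pi> T x y"
  using assms unfolding pi_adic_complete_iff by simp

lemma pi_lim_unique:
  assumes T: "pi_adic_complete (*s) \<pi> T" "subspace T"
    and lim: "pi_lim (*s) \<pi> T x y" "pi_lim (*s) \<pi> T x y'"
  shows "y = y'"
proof -
  have "y' - y \<in> (*s) (\<pi> ^ r) ` T" for r
  proof -
    obtain N N' where "\<forall>n\<ge>N. x n - y \<in> (*s) (\<pi> ^ r) ` T" "\<forall>n\<ge>N'. x n - y' \<in> (*s) (\<pi> ^ r) ` T"
      using lim unfolding pi_lim_def by meson
    then have "x (max N N') - y \<in> (*s) (\<pi> ^ r) ` T" "x (max N N') - y' \<in> (*s) (\<pi> ^ r) ` T"
      by auto
    moreover have "y' - y = (x (max N N') - y) - (x (max N N') - y')" by simp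
    ultimately show ?thesis using subspace_diff[OF subspace_scale_image[OF T(2)]] by metis
  qed
  then have "y' - y = 0" by (rule pi_adic_complete_separated[OF T(1)])
  then show ?thesis by simp
qed

lemma pi_lim_in_set_plus:
  assumes T: "subspace T" and lim: "pi_lim (*s) \<pi> T x y"
    and x: "\<And>n. n \<ge> N \<Longrightarrow> x n \<in> A + (*s) (\<pi> ^ k) ` T"
  shows "y \<in> A + (*s) (\<pi> ^ k) ` T"
proof -
  obtain M where M: "\<forall>n\<ge>M. x n - y \<in> (*s) (\<pi> ^ k) ` T" using lim unfolding pi_lim_def by blast
  define n where "n = max N M"
  have "x n \<in> A + (*s) (\<pi> ^ k) ` T" using x n_def by simp
  then obtain a b where ab: "a \<in> A" "b \<in> (*s) (\<pi> ^ k) ` T" "x n = a + b"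
    by (rule set_plus_elim)
  have "b - (x n - y) \<in> (*s) (\<pi> ^ k) ` T"
    using ab(2) M n_def subspace_diff[OF subspace_scale_image[OF T]] by auto
  moreover have "y = a + (b - (x n - y))" using ab(3) by (simp add: algebra_simps)
  ultimately show ?thesis using ab(1) set_plus_intro by metis
qed

lemma scale_pow_eq_zero:
  assumes tf: "alg_torsionfree (*s)" and "\<pi> \<noteq> 0" and "(\<pi> ^ k) *s x = 0"
  shows "x = 0"
  using assms(3)
proof (induction k arbitrary: x)
  case (Suc k)
  then have "\<pi> *s ((\<pi> ^ k) *s x) = 0" by (simp add: mult.commute)
  then have "(\<pi> ^ k) *s x = 0" using tf \<open>\<pi> \<noteq> 0\<close> unfolding alg_torsionfree_def by blast
  then show ?case by (rule Suc.IH)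
qed simp

lemma scale_pow_cancel:
  assumes tf: "alg_torsionfree (*s)" and "\<pi> \<noteq> 0"
    and "(\<pi> ^ k) *s x \<in> (*s) (\<pi> ^ (k + r)) ` T"
  shows "x \<in> (*s) (\<pi> ^ r) ` T"
proof -
  obtain t where t: "t \<in> T" "(\<pi> ^ k) *s x = (\<pi> ^ (k + r)) *s t" using assms(3) by blast
  then have "(\<pi> ^ k) *s (x - (\<pi> ^ r) *s t) = 0"
    by (simp add: scale_right_diff_distrib power_add)
  then have "x = (\<pi> ^ r) *s t" using scale_pow_eq_zero[OF tf \<open>\<pi> \<noteq> 0\<close>] by fastforce
  then show ?thesis using t(1) by blast
qed

lemma scale_pow_image_closed:
  assumes tf: "alg_torsionfree (*s)" and "\<pi> \<noteq> 0"
    and T: "pi_adic_complete (*s) \<pi> T" "subspace T" and "W \<subseteq> T"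
    and closed: "pi_closed_in (*s) \<pi> T W"
    and z: "\<And>j. z j \<in> (*s) (\<pi> ^ k) ` W" and lim: "pi_lim (*s) \<pi> T z z0"
  shows "z0 \<in> (*s) (\<pi> ^ k) ` W"
proof -
  from z have "\<forall>j. \<exists>w. w \<in> W \<and> z j = (\<pi> ^ k) *s w" by blast
  then obtain v where "\<forall>j. v j \<in> W \<and> z j = (\<pi> ^ k) *s v j" by (rule exE[OF choice])
  then have v: "\<And>j. v j \<in> W" and z_eq: "z = (\<lambda>j. (\<pi> ^ k) *s v j)" by auto
  have "pi_cauchy (*s) \<pi> T v"
    unfolding pi_cauchy_def
  proof
    fix r
    obtain M where M: "\<forall>j\<ge>M. z j - z0 \<in> (*s) (\<pi> ^ (k + r)) ` T"
      using lim unfolding pi_lim_def by blast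
    have "v i - v j \<in> (*s) (\<pi> ^ r) ` T" if "i \<ge> M" "j \<ge> M" for i j
    proof (rule scale_pow_cancel[OF tf \<open>\<pi> \<noteq> 0\<close>])
      have "(\<pi> ^ k) *s (v i - v j) = (z i - z0) - (z j - z0)"
        unfolding z_eq by (simp add: scale_right_diff_distrib)
      then show "(\<pi> ^ k) *s (v i - v j) \<in> (*s) (\<pi> ^ (k + r)) ` T"
        using M that subspace_diff[OF subspace_scale_image[OF T(2)]] by metis
    qed
    then show "\<exists>M. \<forall>i\<ge>M. \<forall>j\<ge>M. v i - v j \<in> (*s) (\<pi> ^ r) ` T" by blast
  qed
  then obtain w where w: "w \<in> T" "pi_lim (*s) \<pi> T v w"
    using pi_adic_completeD[OF T(1)] v \<open>W \<subseteq> T\<close> by blast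
  have "w \<in> W" using closed v w unfolding pi_closed_in_def by blast
  have "pi_lim (*s) \<pi> T z ((\<pi> ^ k) *s w)" unfolding z_eq by (rule pi_lim_scale[OF T(2) w(2)])
  then have "z0 = (\<pi> ^ k) *s w" using pi_lim_unique[OF T lim] by blast
  then show ?thesis using \<open>w \<in> W\<close> by blast
qed

lemma pi_lim_in_closed_subspace:
  assumes tf: "alg_torsionfree (*s)" and "\<pi> \<noteq> 0"
    and T: "pi_adic_complete (*s) \<pi> T" "subspace T"
    and "W \<subseteq> T" and closed: "pi_closed_in (*s) \<pi> T W"
    and cauchy: "pi_cauchy (*s) \<pi> W x" and lim: "pi_lim (*s) \<pi> T x y"
  shows "pi_lim (*s) \<pi> W x y"
  unfolding pi_lim_def
proof
  fix k
  obtain N where N: "\<forall>m\<ge>N. \<forall>n\<ge>N. x m - x n \<in> (*s) (\<pi> ^ k) ` W"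
    using cauchy unfolding pi_cauchy_def by blast
  have "x m - y \<in> (*s) (\<pi> ^ k) ` W" if "m \<ge> N" for m
  proof (rule scale_pow_image_closed[OF tf \<open>\<pi> \<noteq> 0\<close> T \<open>W \<subseteq> T\<close> closed])
    show "x m - x (max N j) \<in> (*s) (\<pi> ^ k) ` W" for j using N that by simp
    show "pi_lim (*s) \<pi> T (\<lambda>j. x m - x (max N j)) (x m - y)"
      unfolding pi_lim_def
    proof
      fix r
      obtain M where M: "\<forall>j\<ge>M. x j - y \<in> (*s) (\<pi> ^ r) ` T" using lim unfolding pi_lim_def by blast
      have "- (x (max N j) - y) \<in> (*s) (\<pi> ^ r) ` T" if "j \<ge> M" for j
        using M that by (intro subspace_neg[OF subspace_scale_image[OF T(2)]]) simp
      moreover have "x m - x (max N j) - (x m - y) = - (x (max N j) - y)" for j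
        by simp
      ultimately show "\<exists>M. \<forall>j\<ge>M. x m - x (max N j) - (x m - y) \<in> (*s) (\<pi> ^ r) ` T"
        by auto
    qed
  qed
  then show "\<exists>N. \<forall>m\<ge>N. x m - y \<in> (*s) (\<pi> ^ k) ` W" by blast
qed

lemma pi_adic_complete_if_closed:
  assumes tf: "alg_torsionfree (*s)" and "\<pi> \<noteq> 0"
    and T: "pi_adic_complete (*s) \<pi> T" "subspace T"
    and W: "subspace W" "W \<subseteq> T" and closed: "pi_closed_in (*s) \<pi> T W"
  shows "pi_adic_complete (*s) \<pi> W"
  unfolding pi_adic_complete_iff
proof (intro conjI allI impI)
  show "(\<Inter>n. (*s) (\<pi> ^ n) ` W) = {0}"
  proof (intro equalityI subsetI)
    fix z :: 'b assume "z \<in> (\<Inter>n. (*s) (\<pi> ^ n) ` W)"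
    then have "z \<in> (*s) (\<pi> ^ r) ` T" for r using W(2) by blast
    then show "z \<in> {0}" using pi_adic_complete_separated[OF T(1)] by blast
  next
    fix z :: 'b assume "z \<in> {0}"
    then show "z \<in> (\<Inter>n. (*s) (\<pi> ^ n) ` W)" using subspace_0[OF W(1)] by force
  qed
next
  fix x assume x: "\<forall>n. x n \<in> W" and cauchy: "pi_cauchy (*s) \<pi> W x"
  have "pi_cauchy (*s) \<pi> T x" using cauchy W(2) unfolding pi_cauchy_def by blast
  then obtain y where "y \<in> T" and lim: "pi_lim (*s) \<pi> T x y"
    using pi_adic_completeD[OF T(1)] x W(2) by blast
  then have "y \<in> W" using closed x unfolding pi_closed_in_def by blast
  moreover have "pi_lim (*s) \<pi> W x y"
    by (rule pi_lim_in_closed_subspace[OF tf \<open>\<pi> \<noteq> 0\<close> T W(2) closed cauchy lim])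
  ultimately show "\<exists>y\<in>W. pi_lim (*s) \<pi> W x y" by blast
qed

end

section \<open>Compactoid subsets\<close>

context module
begin

lemma compactoid_iff:
  "compactoid (*s) \<pi> B S \<longleftrightarrow> (\<exists>T\<in>B. subspace T \<and> S \<subseteq> T \<and>
     (\<forall>n. \<exists>F. finite F \<and> F \<subseteq> T \<and> S \<subseteq> span F + (*s) (\<pi> ^ n) ` T))"
  unfolding compactoid_def set_plus_eq_Collect ..

lemma compactoidI:
  assumes "T \<in> B" "subspace T" "S \<subseteq> T" "\<And>n. finite (F n)" "\<And>n. F n \<subseteq> T"
    "\<And>n. S \<subseteq> span (F n) + (*s) (\<pi> ^ n) ` T"
  shows "compactoid (*s) \<pi> B S"
  unfolding compactoid_iff
proof (intro bexI[of _ T] conjI allI)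
  show "\<exists>F'. finite F' \<and> F' \<subseteq> T \<and> S \<subseteq> span F' + (*s) (\<pi> ^ n) ` T" for n
    using assms(4-6) by (intro exI[of _ "F n"] conjI)
qed (use assms in auto)

lemma compactoidE:
  assumes "compactoid (*s) \<pi> B S"
  obtains T F where "T \<in> B" "subspace T" "S \<subseteq> T" "\<And>n. finite (F n)" "\<And>n. F n \<subseteq> T"
    "\<And>n. S \<subseteq> span (F n) + (*s) (\<pi> ^ n) ` T"
proof -
  obtain T where T: "T \<in> B" "subspace T" "S \<subseteq> T"
    and ex: "\<forall>n. \<exists>F. finite F \<and> F \<subseteq> T \<and> S \<subseteq> span F + (*s) (\<pi> ^ n) ` T"
    using assms unfolding compactoid_iff by blast
  from ex have "\<exists>F. \<forall>n. finite (F n) \<and> F n \<subseteq> T \<and> S \<subseteq> span (F n) + (*s) (\<pi> ^ n) ` T"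
    by (rule choice)
  then obtain F where F: "\<forall>n. finite (F n) \<and> F n \<subseteq> T \<and> S \<subseteq> span (F n) + (*s) (\<pi> ^ n) ` T" ..
  show ?thesis by (rule that[where F = F, OF T]) (use F in auto)
qed

lemma compactoid_subset:
  assumes "compactoid (*s) \<pi> B S" and "S' \<subseteq> S"
  shows "compactoid (*s) \<pi> B S'"
proof -
  obtain T F where S: "T \<in> B" "subspace T" "S \<subseteq> T" "\<And>n. finite (F n)" "\<And>n. F n \<subseteq> T"
    "\<And>n. S \<subseteq> span (F n) + (*s) (\<pi> ^ n) ` T"
    using assms(1) by (elim compactoidE) (rule that)
  show ?thesis
  proof (rule compactoidI[OF S(1,2) _ S(4,5)])
    show "S' \<subseteq> T" using assms(2) S(3) by (rule subset_trans)
    show "S' \<subseteq> span (F n) + (*s) (\<pi> ^ n) ` T" for n using assms(2) S(6) by (rule subset_trans)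
  qed
qed

end

locale bornological_module = module s
  for s :: "'a::comm_ring_1 \<Rightarrow> 'b::ab_group_add \<Rightarrow> 'b" (infixr \<open>*s\<close> 75) +
  fixes \<pi> :: 'a and B :: "'b set set"
  assumes born_module: "born_module s B"
begin

lemma bornology_bounded: "bornology B"
  using born_module unfolding born_module_def by simp

lemma bounded_subset:
  assumes "S \<in> B" and "T \<subseteq> S"
  shows "T \<in> B"
proof -
  have "\<forall>S\<in>B. \<forall>T. T \<subseteq> S \<longrightarrow> T \<in> B" using bornology_bounded unfolding bornology_def by simp
  with assms show ?thesis by blast
qed

lemma bounded_Un: "S \<in> B \<Longrightarrow> T \<in> B \<Longrightarrow> S \<union> T \<in> B"
  using bornology_bounded unfolding bornology_def by simp

lemma finite_bounded: "finite S \<Longrightarrow> S \<in> B"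
  using bornology_bounded unfolding bornology_def by simp

lemma bounded_in_subspace: "S \<in> B \<Longrightarrow> \<exists>T\<in>B. subspace T \<and> S \<subseteq> T"
  using born_module unfolding born_module_def by simp

lemma compactoid_imp_bounded: "compactoid (*s) \<pi> B S \<Longrightarrow> S \<in> B"
  by (erule compactoidE) (rule bounded_subset)

lemma finite_compactoid:
  assumes "finite S"
  shows "compactoid (*s) \<pi> B S"
proof -
  obtain T where T: "T \<in> B" "subspace T" "S \<subseteq> T"
    using bounded_in_subspace finite_bounded[OF assms] by blast
  show ?thesis
  proof (rule compactoidI[OF T, where F = "\<lambda>_. S"])
    show "finite S" "S \<subseteq> T" by (fact assms, fact T(3))
    fix n
    have "0 \<in> (*s) (\<pi> ^ n) ` T" using subspace_0[OF subspace_scale_image[OF T(2)]] .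
    then have "x + 0 \<in> span S + (*s) (\<pi> ^ n) ` T" if "x \<in> S" for x
      using set_plus_intro[OF span_base[OF that]] by blast
    then show "S \<subseteq> span S + (*s) (\<pi> ^ n) ` T" by auto
  qed
qed

lemma compactoid_set_plus:
  assumes "compactoid (*s) \<pi> B X" and "compactoid (*s) \<pi> B Y"
  shows "compactoid (*s) \<pi> B (X + Y)"
proof -
  obtain TX FX where X: "TX \<in> B" "subspace TX" "X \<subseteq> TX" "\<And>n. finite (FX n)" "\<And>n. FX n \<subseteq> TX"
    "\<And>n. X \<subseteq> span (FX n) + (*s) (\<pi> ^ n) ` TX"
    using assms(1) by (elim compactoidE) (rule that)
  obtain TY FY where Y: "TY \<in> B" "subspace TY" "Y \<subseteq> TY" "\<And>n. finite (FY n)" "\<And>n. FY n \<subseteq> TY"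
    "\<And>n. Y \<subseteq> span (FY n) + (*s) (\<pi> ^ n) ` TY"
    using assms(2) by (elim compactoidE) (rule that)
  obtain T where T: "T \<in> B" "subspace T" "TX \<union> TY \<subseteq> T"
    using bounded_in_subspace[OF bounded_Un[OF X(1) Y(1)]] by blast
  show ?thesis
  proof (rule compactoidI[OF T(1,2)])
    show "X + Y \<subseteq> T" using X(3) Y(3) T by (intro set_plus_subset_subspace) auto
    show "finite (FX n \<union> FY n)" for n using X(4) Y(4) by simp
    show "FX n \<union> FY n \<subseteq> T" for n using X(5) Y(5) T(3) by blast
    fix n
    have "X + Y \<subseteq> (span (FX n) + (*s) (\<pi> ^ n) ` TX) + (span (FY n) + (*s) (\<pi> ^ n) ` TY)"
      using X(6) Y(6) by (rule set_plus_mono2)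
    also have "\<dots> = (span (FX n) + span (FY n)) + ((*s) (\<pi> ^ n) ` TX + (*s) (\<pi> ^ n) ` TY)"
      by (simp only: add.assoc add.left_commute)
    also have "\<dots> \<subseteq> span (FX n \<union> FY n) + (*s) (\<pi> ^ n) ` T"
    proof (rule set_plus_mono2)
      show "span (FX n) + span (FY n) \<subseteq> span (FX n \<union> FY n)"
        by (rule set_plus_subset_subspace[OF subspace_span]; rule span_mono; blast)
      show "(*s) (\<pi> ^ n) ` TX + (*s) (\<pi> ^ n) ` TY \<subseteq> (*s) (\<pi> ^ n) ` T"
        by (rule set_plus_subset_subspace[OF subspace_scale_image[OF T(2)]]) (use T(3) in auto)
    qed
    finally show "X + Y \<subseteq> span (FX n \<union> FY n) + (*s) (\<pi> ^ n) ` T" .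
  qed
qed

lemma compactoid_insert_zero:
  assumes "compactoid (*s) \<pi> B X"
  shows "compactoid (*s) \<pi> B (insert 0 X)"
proof -
  obtain T F where X: "T \<in> B" "subspace T" "X \<subseteq> T" "\<And>n. finite (F n)" "\<And>n. F n \<subseteq> T"
    "\<And>n. X \<subseteq> span (F n) + (*s) (\<pi> ^ n) ` T"
    using assms by (elim compactoidE) (rule that)
  show ?thesis
  proof (rule compactoidI[OF X(1,2)])
    show "insert 0 X \<subseteq> T" using X(3) subspace_0[OF X(2)] by blast
    show "finite (F n)" "F n \<subseteq> T" for n by (fact X(4), fact X(5))
    have "0 \<in> span (F n) + (*s) (\<pi> ^ n) ` T" for n
      using set_plus_intro[OF span_zero subspace_0[OF subspace_scale_image[OF X(2)]]] by simp
    then show "insert 0 X \<subseteq> span (F n) + (*s) (\<pi> ^ n) ` T" for n using X(6) by simp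
  qed
qed

lemma compactoid_Un:
  assumes "compactoid (*s) \<pi> B X" and "compactoid (*s) \<pi> B Y"
  shows "compactoid (*s) \<pi> B (X \<union> Y)"
proof (rule compactoid_subset)
  show "compactoid (*s) \<pi> B (insert 0 X + insert 0 Y)"
    using assms by (intro compactoid_set_plus compactoid_insert_zero)
  show "X \<union> Y \<subseteq> insert 0 X + insert 0 Y"
    by (auto simp: insert_set_plus set_plus_insert)
qed

lemma bornology_compactoid_born: "bornology (compactoid_born (*s) \<pi> B)"
  unfolding bornology_def compactoid_born_def Ball_def mem_Collect_eq
proof (intro conjI allI ballI impI)
  show "compactoid (*s) \<pi> B S" if "finite S" for S using that by (rule finite_compactoid)
  show "compactoid (*s) \<pi> B (S \<union> T)" if "compactoid (*s) \<pi> B S" "compactoid (*s) \<pi> B T" for S T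
    using that by (rule compactoid_Un)
  show "compactoid (*s) \<pi> B T" if "compactoid (*s) \<pi> B S" "T \<subseteq> S" for S T
    using that by (rule compactoid_subset)
qed

end

locale complete_torsionfree_module = bornological_module +
  assumes complete: "\<forall>S\<in>B. \<exists>T\<in>B. subspace T \<and> pi_adic_complete s \<pi> T \<and> S \<subseteq> T"
    and torsionfree: "alg_torsionfree s"
    and pi_nonzero: "\<pi> \<noteq> 0"
begin

lemma bounded_in_complete_subspace:
  assumes "S \<in> B"
  obtains T where "T \<in> B" "subspace T" "pi_adic_complete s \<pi> T" "S \<subseteq> T"
  using complete assms by blast

lemma compactoid_complete_hull:
  assumes "compactoid (*s) \<pi> B S"
  obtains W where "compactoid (*s) \<pi> B W" "subspace W" "pi_adic_complete (*s) \<pi> W" "S \<subseteq> W"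
proof -
  obtain T0 F where S: "T0 \<in> B" "subspace T0" "S \<subseteq> T0" "\<And>n. finite (F n)" "\<And>n. F n \<subseteq> T0"
    "\<And>n. S \<subseteq> span (F n) + (*s) (\<pi> ^ n) ` T0"
    using assms by (elim compactoidE) (rule that)
  obtain T where T: "T \<in> B" "subspace T" "pi_adic_complete (*s) \<pi> T" "T0 \<subseteq> T"
    using S(1) by (rule bounded_in_complete_subspace)
  define W where "W = T \<inter> (\<Inter>n. span (F n) + (*s) (\<pi> ^ n) ` T)"
  have "subspace W"
    unfolding W_def using T(2)
    by (intro subspace_inter subspace_Int subspace_set_plus subspace_span subspace_scale_image)
  moreover have "S \<subseteq> W"
  proof -
    have "S \<subseteq> span (F n) + (*s) (\<pi> ^ n) ` T" for n
      using S(6) set_plus_mono2[OF order_refl image_mono[OF T(4)]] by (rule subset_trans)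
    then show ?thesis unfolding W_def using S(3) T(4) by blast
  qed
  moreover have "compactoid (*s) \<pi> B W"
  proof (rule compactoidI[OF T(1,2)])
    show "W \<subseteq> T" "finite (F n)" "F n \<subseteq> T" for n using S(4,5) T(4) unfolding W_def by auto
    show "W \<subseteq> span (F n) + (*s) (\<pi> ^ n) ` T" for n unfolding W_def by auto
  qed
  moreover have "pi_adic_complete (*s) \<pi> W"
  proof (rule pi_adic_complete_if_closed[OF torsionfree pi_nonzero T(3,2) \<open>subspace W\<close>])
    show "W \<subseteq> T" unfolding W_def by auto
    show "pi_closed_in (*s) \<pi> T W"
      unfolding pi_closed_in_def
    proof (intro allI impI)
      fix x y assume x: "\<forall>n. x n \<in> W" and "y \<in> T" and lim: "pi_lim (*s) \<pi> T x y"
      have "y \<in> span (F k) + (*s) (\<pi> ^ k) ` T" for k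
        using x unfolding W_def by (intro pi_lim_in_set_plus[OF T(2) lim, where N = 0]) auto
      then show "y \<in> W" unfolding W_def using \<open>y \<in> T\<close> by auto
    qed
  qed
  ultimately show ?thesis using that by blast
qed

lemma complete_compactoid_born: "complete_born_module s \<pi> (compactoid_born s \<pi> B)"
proof -
  have hull: "\<exists>W\<in>compactoid_born s \<pi> B. subspace W \<and> pi_adic_complete s \<pi> W \<and> S \<subseteq> W"
    if "S \<in> compactoid_born s \<pi> B" for S
  proof -
    from that have "compactoid (*s) \<pi> B S" by (simp add: compactoid_born_def)
    then obtain W where "compactoid (*s) \<pi> B W" "subspace W" "pi_adic_complete (*s) \<pi> W" "S \<subseteq> W"
      by (rule compactoid_complete_hull)
    then show ?thesis by (intro bexI[of _ W]) (simp_all add: compactoid_born_def)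
  qed
  then have "\<exists>W\<in>compactoid_born s \<pi> B. subspace W \<and> S \<subseteq> W" if "S \<in> compactoid_born s \<pi> B" for S
    using that by fast
  with hull show ?thesis
    unfolding complete_born_module_def born_module_def
    using module_axioms bornology_compactoid_born by simp
qed

end

lemma complete_torsionfree_moduleI:
  assumes "complete_born_module s \<pi> B" and "born_torsionfree s \<pi> B" and "\<pi> \<noteq> 0"
  shows "complete_torsionfree_module s \<pi> B"
proof -
  have "born_module s B" using assms(1) by (simp add: complete_born_module_def)
  then have "bornological_module s B"
    by (intro bornological_module.intro bornological_module_axioms.intro) (simp_all add: born_module_def)
  then show ?thesis
    using assms unfolding complete_born_module_def born_torsionfree_def
    by (intro complete_torsionfree_module.intro complete_torsionfree_module_axioms.intro) simp_all
qed

section \<open>Modules over a discrete valuation ring\<close>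

lemma dvr_least_valuation_divides:
  fixes \<pi> :: "'a::idom" and I :: "'a set"
  assumes dvr: "dvr_uniformiser \<pi>" and "c \<in> I"
  shows "\<exists>c0\<in>I. \<forall>c\<in>I. c0 dvd c"
proof (cases "I \<subseteq> {0}")
  case True
  then show ?thesis using \<open>c \<in> I\<close> by auto
next
  case False
  define has_val where "has_val n \<longleftrightarrow> (\<exists>c\<in>I. \<exists>u. u dvd 1 \<and> c = u * \<pi> ^ n)" for n
  have val: "\<exists>u n. u dvd 1 \<and> c = u * \<pi> ^ n" if "c \<noteq> 0" for c
    using dvr that unfolding dvr_uniformiser_def by blast
  from False obtain c where "c \<in> I" "c \<noteq> 0" by auto
  with val have "\<exists>n. has_val n" unfolding has_val_def by metis
  define n0 where "n0 = (LEAST n. has_val n)"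
  have "has_val n0" unfolding n0_def using \<open>\<exists>n. has_val n\<close> by (rule LeastI_ex)
  then obtain c0 u0 where c0: "c0 \<in> I" "u0 dvd 1" "c0 = u0 * \<pi> ^ n0"
    unfolding has_val_def by blast
  obtain w where w: "1 = u0 * w" using c0(2) by (rule dvdE)
  have "c0 dvd c" if "c \<in> I" for c
  proof (cases "c = 0")
    case False
    then obtain u n where u: "u dvd 1" "c = u * \<pi> ^ n" using val by blast
    then have "has_val n" using that unfolding has_val_def by blast
    then have "n0 \<le> n" unfolding n0_def by (rule Least_le)
    then have "\<pi> ^ n = \<pi> ^ (n - n0) * \<pi> ^ n0" by (simp flip: power_add)
    then have "c = (u * w * \<pi> ^ (n - n0)) * (u0 * \<pi> ^ n0)"
      using u(2) w by (metis mult.assoc mult.commute mult.left_neutral)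
    then show ?thesis using c0(3) by simp
  qed simp
  then show ?thesis using c0(1) by blast
qed

locale dvr_module = module s
  for s :: "'a::idom \<Rightarrow> 'b::ab_group_add \<Rightarrow> 'b" (infixr \<open>*s\<close> 75) +
  fixes \<pi> :: 'a
  assumes dvr: "dvr_uniformiser \<pi>"
begin

lemma finitely_generated_subspace:
  assumes "finite F" "subspace N" "N \<subseteq> span F"
  shows "\<exists>G. finite G \<and> G \<subseteq> N \<and> N \<subseteq> span G"
  using assms
proof (induction F arbitrary: N rule: finite_induct)
  case empty
  then show ?case by (intro exI[of _ "{}"]) auto
next
  case (insert x F)
  \<comment> \<open>The x-coefficients of elements of N form an ideal I, generated by its element c0 of least
    valuation; so N is spanned by one element y0 with coefficient c0 together with N \<inter> span F.\<close>
  define I where "I = {c. \<exists>m\<in>span F. m + c *s x \<in> N}"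
  have "0 + 0 *s x \<in> N" using subspace_0[OF insert.prems(1)] by simp
  then have "0 \<in> I" unfolding I_def by (intro CollectI bexI[OF _ span_zero])
  obtain c0 where "c0 \<in> I" and c0_dvd: "\<forall>c\<in>I. c0 dvd c"
    using dvr_least_valuation_divides[OF dvr \<open>0 \<in> I\<close>] by blast
  then obtain m0 where m0: "m0 \<in> span F" "m0 + c0 *s x \<in> N" unfolding I_def by blast
  define y0 where "y0 = m0 + c0 *s x"
  obtain G where G: "finite G" "G \<subseteq> N \<inter> span F" "N \<inter> span F \<subseteq> span G"
    using insert.IH[OF subspace_inter[OF insert.prems(1) subspace_span] Int_lower2] by blast
  have "N \<subseteq> span (insert y0 G)"
  proof
    fix y assume "y \<in> N"
    then have "y \<in> span (insert x F)" by (rule subsetD[OF insert.prems(2)])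
    then obtain k where k: "y - k *s x \<in> span F" by (auto simp: span_breakdown_eq)
    have "(y - k *s x) + k *s x \<in> N" using \<open>y \<in> N\<close> by simp
    then have "k \<in> I" unfolding I_def using k by blast
    with c0_dvd obtain d where "k = c0 * d" by (blast elim: dvdE)
    then have y_eq: "y - d *s y0 = (y - k *s x) - d *s m0"
      by (simp add: y0_def scale_right_distrib algebra_simps mult.commute)
    have "y - d *s y0 \<in> N"
      using \<open>y \<in> N\<close> m0(2) insert.prems(1) unfolding y0_def by (intro subspace_diff subspace_scale)
    moreover have "y - d *s y0 \<in> span F"
      unfolding y_eq using k m0(1) by (rule span_diff[OF _ span_scale])
    ultimately have "y - d *s y0 \<in> span G" using G(3) by blast
    then have "y - d *s y0 \<in> span (insert y0 G)" using span_mono[of G "insert y0 G"] by blast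
    moreover have "d *s y0 \<in> span (insert y0 G)" by (intro span_scale span_base insertI1)
    ultimately have "(y - d *s y0) + d *s y0 \<in> span (insert y0 G)" by (rule span_add)
    then show "y \<in> span (insert y0 G)" by simp
  qed
  moreover have "insert y0 G \<subseteq> N" using G(2) m0(2) unfolding y0_def by blast
  ultimately show ?case using G(1) by blast
qed

end

section \<open>Images and lifts along module homomorphisms\<close>

context module_hom
begin

lemma image_set_plus: "f ` (A + B) = f ` A + f ` B"
proof (intro equalityI subsetI)
  fix y assume "y \<in> f ` (A + B)"
  then obtain a b where "a \<in> A" "b \<in> B" "y = f (a + b)" by (auto elim: set_plus_elim)
  then show "y \<in> f ` A + f ` B" by (simp add: add set_plus_intro)
next
  fix y assume "y \<in> f ` A + f ` B"
  then obtain a b where "a \<in> A" "b \<in> B" "y = f a + f b" by (auto elim: set_plus_elim)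
  then show "y \<in> f ` (A + B)" by (metis add image_eqI set_plus_intro)
qed

lemma image_scale_image: "f ` s1 c ` T = s2 c ` f ` T"
  by (auto simp: image_image scale)

lemma compactoid_image:
  assumes "compactoid s1 \<pi> B1 S" and "bounded_map B1 B2 f"
  shows "compactoid s2 \<pi> B2 (f ` S)"
proof -
  obtain T F where S: "T \<in> B1" "m1.subspace T" "S \<subseteq> T" "\<And>n. finite (F n)" "\<And>n. F n \<subseteq> T"
    "\<And>n. S \<subseteq> m1.span (F n) + s1 (\<pi> ^ n) ` T"
    using assms(1) by (elim m1.compactoidE) (rule that)
  show ?thesis
  proof (rule m2.compactoidI[where F = "\<lambda>n. f ` F n"])
    show "f ` T \<in> B2" using assms(2) S(1) unfolding bounded_map_def by blast
    show "m2.subspace (f ` T)" by (rule subspace_image[OF S(2)])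
    show "f ` S \<subseteq> f ` T" using S(3) by (rule image_mono)
    show "finite (f ` F n)" "f ` F n \<subseteq> f ` T" for n using S(4,5) by auto
    have "f ` S \<subseteq> f ` (m1.span (F n) + s1 (\<pi> ^ n) ` T)" for n using S(6) by (rule image_mono)
    then show "f ` S \<subseteq> m2.span (f ` F n) + s2 (\<pi> ^ n) ` f ` T" for n
      by (simp add: image_set_plus image_scale_image span_image)
  qed
qed

lemma pi_lim_image:
  assumes "pi_lim s1 \<pi> T x y"
  shows "pi_lim s2 \<pi> (f ` T) (\<lambda>n. f (x n)) (f y)"
  unfolding pi_lim_def
proof
  fix k
  obtain N where "\<forall>n\<ge>N. x n - y \<in> s1 (\<pi> ^ k) ` T" using assms unfolding pi_lim_def by blast
  then have "\<forall>n\<ge>N. f (x n - y) \<in> s2 (\<pi> ^ k) ` f ` T" by (auto simp: scale)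
  then show "\<exists>N. \<forall>n\<ge>N. f (x n) - f y \<in> s2 (\<pi> ^ k) ` f ` T" by (auto simp: diff)
qed

lemma lift_approximants:
  assumes T: "m1.subspace T" and p: "\<And>n. p \<in> m2.span (f ` H n) + s2 (\<pi> ^ n) ` f ` T"
  obtains b where "\<And>n. b n \<in> m1.span (H n)" "\<And>n. f (b n) - p \<in> s2 (\<pi> ^ n) ` f ` T"
proof -
  have "\<exists>b. b \<in> m1.span (H n) \<and> f b - p \<in> s2 (\<pi> ^ n) ` f ` T" for n
  proof -
    obtain a c where a: "a \<in> m2.span (f ` H n)" and c: "c \<in> s2 (\<pi> ^ n) ` f ` T" and "p = a + c"
      using p[of n] by (elim set_plus_elim) simp
    from a obtain b where "b \<in> m1.span (H n)" "f b = a" by (auto simp: span_image)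
    moreover have "- c \<in> s2 (\<pi> ^ n) ` f ` T"
      using c by (rule m2.subspace_neg[OF m2.subspace_scale_image[OF subspace_image[OF T]]])
    ultimately show ?thesis using \<open>p = a + c\<close> by (intro exI[of _ b]) simp
  qed
  then have "\<exists>b. \<forall>n. b n \<in> m1.span (H n) \<and> f (b n) - p \<in> s2 (\<pi> ^ n) ` f ` T"
    by (intro choice allI)
  then obtain b where b: "\<forall>n. b n \<in> m1.span (H n) \<and> f (b n) - p \<in> s2 (\<pi> ^ n) ` f ` T" ..
  show ?thesis by (rule that[of b]) (use b in simp_all)
qed

lemma kernel_corrected_steps:
  assumes T: "m1.subspace T"
    and correction: "\<And>n. m1.span (H n \<union> H (Suc n)) \<inter> f -` (s2 (\<pi> ^ n) ` f ` T)
      \<subseteq> s1 (\<pi> ^ n) ` T + m1.span (Z n)"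
    and b: "\<And>n. b n \<in> m1.span (H n)" "\<And>n. f (b n) - p \<in> s2 (\<pi> ^ n) ` f ` T"
  obtains v where "\<And>n. v n \<in> s1 (\<pi> ^ n) ` T" "\<And>n. b (Suc n) - b n - v n \<in> m1.span (Z n)"
proof -
  have fT: "m2.subspace (s2 (\<pi> ^ n) ` f ` T)" for n
    by (rule m2.subspace_scale_image[OF subspace_image[OF T]])
  have "\<exists>v. v \<in> s1 (\<pi> ^ n) ` T \<and> b (Suc n) - b n - v \<in> m1.span (Z n)" for n
  proof -
    have "b (Suc n) \<in> m1.span (H n \<union> H (Suc n))" "b n \<in> m1.span (H n \<union> H (Suc n))"
      using b(1)[of "Suc n"] b(1)[of n] m1.span_mono[of "H (Suc n)" "H n \<union> H (Suc n)"]
        m1.span_mono[of "H n" "H n \<union> H (Suc n)"] by blast+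
    then have "b (Suc n) - b n \<in> m1.span (H n \<union> H (Suc n))" by (rule m1.span_diff)
    moreover have "f (b (Suc n) - b n) \<in> s2 (\<pi> ^ n) ` f ` T"
    proof -
      have "f (b (Suc n)) - p \<in> s2 (\<pi> ^ n) ` f ` T"
        using b(2)[of "Suc n"] m2.scale_pow_image_antimono[OF subspace_image[OF T], of n "Suc n" \<pi>]
        by auto
      then have "(f (b (Suc n)) - p) - (f (b n) - p) \<in> s2 (\<pi> ^ n) ` f ` T"
        using b(2)[of n] by (rule m2.subspace_diff[OF fT])
      then show ?thesis by (simp add: diff)
    qed
    ultimately have "b (Suc n) - b n \<in> m1.span (H n \<union> H (Suc n)) \<inter> f -` (s2 (\<pi> ^ n) ` f ` T)"
      by simp
    then have "b (Suc n) - b n \<in> s1 (\<pi> ^ n) ` T + m1.span (Z n)" by (rule subsetD[OF correction])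
    then obtain v z where "v \<in> s1 (\<pi> ^ n) ` T" "z \<in> m1.span (Z n)" "b (Suc n) - b n = v + z"
      by (elim set_plus_elim) simp
    then show ?thesis by (intro exI[of _ v]) simp
  qed
  then have "\<exists>v. \<forall>n. v n \<in> s1 (\<pi> ^ n) ` T \<and> b (Suc n) - b n - v n \<in> m1.span (Z n)"
    by (intro choice allI)
  then obtain v where v: "\<forall>n. v n \<in> s1 (\<pi> ^ n) ` T \<and> b (Suc n) - b n - v n \<in> m1.span (Z n)" ..
  show ?thesis by (rule that[of v]) (use v in simp_all)
qed

lemma lift_approximations:
  assumes T: "m1.subspace T" and kernel: "\<And>n. Z n \<subseteq> {z. f z = 0}"
    and correction: "\<And>n. m1.span (H n \<union> H (Suc n)) \<inter> f -` (s2 (\<pi> ^ n) ` f ` T)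
      \<subseteq> s1 (\<pi> ^ n) ` T + m1.span (Z n)"
    and p: "\<And>n. p \<in> m2.span (f ` H n) + s2 (\<pi> ^ n) ` f ` T"
  obtains x where "\<And>n. x n \<in> m1.span (H n \<union> (\<Union>i<n. Z i))"
    "\<And>n. x (Suc n) - x n \<in> s1 (\<pi> ^ n) ` T" "\<And>n. f (x n) - p \<in> s2 (\<pi> ^ n) ` f ` T"
proof -
  obtain b where b: "\<And>n. b n \<in> m1.span (H n)" "\<And>n. f (b n) - p \<in> s2 (\<pi> ^ n) ` f ` T"
    using lift_approximants[OF T p] by blast
  obtain v where v: "\<And>n. v n \<in> s1 (\<pi> ^ n) ` T" "\<And>n. b (Suc n) - b n - v n \<in> m1.span (Z n)"
    using kernel_corrected_steps[OF T correction b] by blast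
  define x where "x n = b n - (\<Sum>i<n. b (Suc i) - b i - v i)" for n
  show ?thesis
  proof (rule that)
    fix n
    have "b (Suc i) - b i - v i \<in> m1.span (H n \<union> (\<Union>i<n. Z i))" if "i \<in> {..<n}" for i
      using v(2)[of i] m1.span_mono[of "Z i" "H n \<union> (\<Union>i<n. Z i)"] that by blast
    then have "(\<Sum>i<n. b (Suc i) - b i - v i) \<in> m1.span (H n \<union> (\<Union>i<n. Z i))"
      by (rule m1.span_sum)
    moreover have "b n \<in> m1.span (H n \<union> (\<Union>i<n. Z i))"
      using b(1)[of n] m1.span_mono[of "H n" "H n \<union> (\<Union>i<n. Z i)"] by blast
    ultimately show "x n \<in> m1.span (H n \<union> (\<Union>i<n. Z i))" unfolding x_def by (rule m1.span_diff[rotated])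
    show "x (Suc n) - x n \<in> s1 (\<pi> ^ n) ` T" using v(1)[of n] by (simp add: x_def algebra_simps)
    have "f (b (Suc i) - b i - v i) = 0" for i
    proof (rule eq_0_on_span[OF _ v(2)])
      show "f z = 0" if "z \<in> Z i" for z using kernel[of i] that by blast
    qed
    then have "f (\<Sum>i<n. b (Suc i) - b i - v i) = 0" by (simp add: sum)
    then show "f (x n) - p \<in> s2 (\<pi> ^ n) ` f ` T" using b(2)[of n] by (simp add: x_def diff)
  qed
qed

lemma lift_approximable_point:
  assumes T: "m1.subspace T" "pi_adic_complete s1 \<pi> T"
    and Q: "m2.subspace Q" "pi_adic_complete s2 \<pi> Q" "f ` T \<subseteq> Q"
    and H: "\<And>n. H n \<subseteq> T" and Z: "\<And>n. Z n \<subseteq> T" and kernel: "\<And>n. Z n \<subseteq> {z. f z = 0}"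
    and correction: "\<And>n. m1.span (H n \<union> H (Suc n)) \<inter> f -` (s2 (\<pi> ^ n) ` f ` T)
      \<subseteq> s1 (\<pi> ^ n) ` T + m1.span (Z n)"
    and p: "\<And>n. p \<in> m2.span (f ` H n) + s2 (\<pi> ^ n) ` f ` T"
  shows "\<exists>y\<in>T. f y = p \<and> (\<forall>n. y \<in> m1.span (H n \<union> (\<Union>i<n. Z i)) + s1 (\<pi> ^ n) ` T)"
proof -
  obtain x where x: "\<And>n. x n \<in> m1.span (H n \<union> (\<Union>i<n. Z i))"
    "\<And>n. x (Suc n) - x n \<in> s1 (\<pi> ^ n) ` T" "\<And>n. f (x n) - p \<in> s2 (\<pi> ^ n) ` f ` T"
    using lift_approximations[OF T(1) kernel correction p] by blast
  have "m1.span (H n \<union> (\<Union>i<n. Z i)) \<subseteq> T" for n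
    using H Z by (intro m1.span_minimal T(1)) auto
  then have xT: "x n \<in> T" for n using x(1) by blast
  have "pi_cauchy s1 \<pi> T x" by (rule m1.pi_cauchy_if_steps[OF T(1) x(2)])
  then obtain y where "y \<in> T" and lim: "pi_lim s1 \<pi> T x y"
    using m1.pi_adic_completeD[OF T(2), where x = x, OF xT] by blast
  have "y \<in> m1.span (H k \<union> (\<Union>i<k. Z i)) + s1 (\<pi> ^ k) ` T" for k
  proof (rule m1.pi_lim_in_set_plus[OF T(1) lim, where N = k])
    fix n assume "k \<le> n"
    have "x n = x k + (x n - x k)" by simp
    moreover have "x n - x k \<in> s1 (\<pi> ^ k) ` T" by (rule m1.scale_pow_telescope[OF T(1) x(2) \<open>k \<le> n\<close>])
    ultimately show "x n \<in> m1.span (H k \<union> (\<Union>i<k. Z i)) + s1 (\<pi> ^ k) ` T"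
      using x(1)[of k] by (metis set_plus_intro)
  qed
  moreover have "f y = p"
  proof (rule m2.pi_lim_unique[OF Q(2,1)])
    show "pi_lim s2 \<pi> Q (\<lambda>n. f (x n)) (f y)" using Q(3) pi_lim_image[OF lim] by (rule pi_lim_mono)
    have "f (x n) - p \<in> s2 (\<pi> ^ n) ` Q" for n using x(3)[of n] Q(3) by blast
    then show "pi_lim s2 \<pi> Q (\<lambda>n. f (x n)) p" by (rule m2.pi_lim_if_diff_scale_pow[OF Q(1)])
  qed
  ultimately show ?thesis using \<open>y \<in> T\<close> by blast
qed

lemma compactoid_lift_if_approximable:
  assumes T: "T \<in> B1" "m1.subspace T" "pi_adic_complete s1 \<pi> T"
    and Q: "m2.subspace Q" "pi_adic_complete s2 \<pi> Q" "f ` T \<subseteq> Q"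
    and H: "\<And>n. finite (H n)" "\<And>n. H n \<subseteq> T"
    and Z: "\<And>n. finite (Z n)" "\<And>n. Z n \<subseteq> T" "\<And>n. Z n \<subseteq> {z. f z = 0}"
    and correction: "\<And>n. m1.span (H n \<union> H (Suc n)) \<inter> f -` (s2 (\<pi> ^ n) ` f ` T)
      \<subseteq> s1 (\<pi> ^ n) ` T + m1.span (Z n)"
    and S: "\<And>n. S \<subseteq> m2.span (f ` H n) + s2 (\<pi> ^ n) ` f ` T"
  shows "\<exists>W. compactoid s1 \<pi> B1 W \<and> S = f ` W"
proof -
  define W where "W = {y \<in> T. f y \<in> S \<and> (\<forall>n. y \<in> m1.span (H n \<union> (\<Union>i<n. Z i)) + s1 (\<pi> ^ n) ` T)}"
  have "compactoid s1 \<pi> B1 W"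
  proof (rule m1.compactoidI[OF T(1,2), where F = "\<lambda>n. H n \<union> (\<Union>i<n. Z i)"])
    show "W \<subseteq> T" unfolding W_def by auto
    show "finite (H n \<union> (\<Union>i<n. Z i))" for n using H(1) Z(1) by simp
    show "H n \<union> (\<Union>i<n. Z i) \<subseteq> T" for n using H(2) Z(2) by blast
    show "W \<subseteq> m1.span (H n \<union> (\<Union>i<n. Z i)) + s1 (\<pi> ^ n) ` T" for n unfolding W_def by auto
  qed
  moreover have "S \<subseteq> f ` W"
  proof
    fix p assume "p \<in> S"
    then have "p \<in> m2.span (f ` H n) + s2 (\<pi> ^ n) ` f ` T" for n by (rule subsetD[OF S])
    then obtain y where "y \<in> T" "f y = p" "\<forall>n. y \<in> m1.span (H n \<union> (\<Union>i<n. Z i)) + s1 (\<pi> ^ n) ` T"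
      using lift_approximable_point[where H = H and Z = Z, OF T(2,3) Q H(2) Z(2,3) correction] by blast
    then have "y \<in> W" unfolding W_def using \<open>p \<in> S\<close> by simp
    with \<open>f y = p\<close> show "p \<in> f ` W" by blast
  qed
  moreover have "f ` W \<subseteq> S" unfolding W_def by auto
  ultimately show ?thesis by (intro exI[of _ W]) auto
qed

end

locale dvr_module_hom = module_hom s1 s2 f
  for s1 :: "'a::idom \<Rightarrow> 'b::ab_group_add \<Rightarrow> 'b" and s2 :: "'a \<Rightarrow> 'c::ab_group_add \<Rightarrow> 'c" and f +
  fixes \<pi> :: 'a
  assumes dvr: "dvr_uniformiser \<pi>"
begin

sublocale source: dvr_module s1 \<pi>
  by (rule dvr_module.intro[OF m1.module_axioms]) (rule dvr_module_axioms.intro[OF dvr])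

lemma pi_divisible_mod_finite_kernel:
  assumes "finite A" "A \<subseteq> T" and T: "m1.subspace T"
  shows "\<exists>Z. finite Z \<and> Z \<subseteq> T \<inter> {z. f z = 0} \<and>
    m1.span A \<inter> f -` (s2 (\<pi> ^ n) ` f ` T) \<subseteq> s1 (\<pi> ^ n) ` T + m1.span Z"
proof -
  define D where "D = m1.span A \<inter> f -` (s2 (\<pi> ^ n) ` f ` T)"
  have "m1.subspace (f -` (s2 (\<pi> ^ n) ` f ` T))"
    by (rule subspace_vimage[OF m2.subspace_scale_image[OF subspace_image[OF T]]])
  then have "m1.subspace D" unfolding D_def by (rule m1.subspace_inter[OF m1.subspace_span])
  moreover have "D \<subseteq> m1.span A" unfolding D_def by (rule Int_lower1)
  ultimately have "\<exists>E. finite E \<and> E \<subseteq> D \<and> D \<subseteq> m1.span E"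
    by (rule source.finitely_generated_subspace[OF assms(1)])
  then obtain E where E: "finite E" "E \<subseteq> D" "D \<subseteq> m1.span E" by blast
  have "\<forall>e\<in>E. \<exists>u. u \<in> T \<and> f e = s2 (\<pi> ^ n) (f u)" using E(2) unfolding D_def by auto
  then have "\<exists>u. \<forall>e\<in>E. u e \<in> T \<and> f e = s2 (\<pi> ^ n) (f (u e))" by (rule bchoice)
  then obtain u where u: "\<forall>e\<in>E. u e \<in> T \<and> f e = s2 (\<pi> ^ n) (f (u e))" ..
  define Z where "Z = (\<lambda>e. e - s1 (\<pi> ^ n) (u e)) ` E"
  have "E \<subseteq> T" using E(2) m1.span_minimal[OF assms(2) T] unfolding D_def by blast
  then have "Z \<subseteq> T" unfolding Z_def using u by (auto intro!: m1.subspace_diff[OF T] m1.subspace_scale[OF T])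
  moreover have "Z \<subseteq> {z. f z = 0}" unfolding Z_def using u by (auto simp: diff scale)
  moreover have "D \<subseteq> s1 (\<pi> ^ n) ` T + m1.span Z"
  proof -
    have "e \<in> s1 (\<pi> ^ n) ` T + m1.span Z" if "e \<in> E" for e
    proof -
      have "s1 (\<pi> ^ n) (u e) \<in> s1 (\<pi> ^ n) ` T" using u that by blast
      moreover have "e - s1 (\<pi> ^ n) (u e) \<in> m1.span Z"
        unfolding Z_def using that by (intro m1.span_base imageI)
      ultimately have "s1 (\<pi> ^ n) (u e) + (e - s1 (\<pi> ^ n) (u e)) \<in> s1 (\<pi> ^ n) ` T + m1.span Z"
        by (rule set_plus_intro)
      then show ?thesis by simp
    qed
    moreover have "m1.subspace (s1 (\<pi> ^ n) ` T + m1.span Z)"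
      by (rule m1.subspace_set_plus[OF m1.subspace_scale_image[OF T] m1.subspace_span])
    ultimately have "m1.span E \<subseteq> s1 (\<pi> ^ n) ` T + m1.span Z" by (intro m1.span_minimal subsetI)
    with E(3) show ?thesis by (rule order_trans)
  qed
  moreover have "finite Z" unfolding Z_def using E(1) by (rule finite_imageI)
  ultimately show ?thesis unfolding D_def by blast
qed

lemma finite_lifts_with_kernel_corrections:
  assumes T: "m1.subspace T" and F: "\<And>n. finite (F n)" "\<And>n. F n \<subseteq> f ` T"
  obtains H Z where "\<And>n. finite (H n)" "\<And>n. H n \<subseteq> T" "\<And>n. F n = f ` H n"
    "\<And>n. finite (Z n)" "\<And>n. Z n \<subseteq> T" "\<And>n. Z n \<subseteq> {z. f z = 0}"
    "\<And>n. m1.span (H n \<union> H (Suc n)) \<inter> f -` (s2 (\<pi> ^ n) ` f ` T) \<subseteq> s1 (\<pi> ^ n) ` T + m1.span (Z n)"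
proof -
  have "\<exists>H\<subseteq>T. finite H \<and> F n = f ` H" for n by (rule finite_subset_image[OF F(1,2)])
  then have "\<forall>n. \<exists>H. H \<subseteq> T \<and> finite H \<and> F n = f ` H" ..
  then obtain H where "\<forall>n. H n \<subseteq> T \<and> finite (H n) \<and> F n = f ` H n" by (rule exE[OF choice])
  then have H: "\<And>n. finite (H n)" "\<And>n. H n \<subseteq> T" "\<And>n. F n = f ` H n" by simp_all
  have "\<exists>Z. finite Z \<and> Z \<subseteq> T \<inter> {z. f z = 0} \<and>
      m1.span (H n \<union> H (Suc n)) \<inter> f -` (s2 (\<pi> ^ n) ` f ` T) \<subseteq> s1 (\<pi> ^ n) ` T + m1.span Z" for n
    by (rule pi_divisible_mod_finite_kernel[OF _ _ T]) (use H(1,2) in auto)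
  then have "\<forall>n. \<exists>Z. finite Z \<and> Z \<subseteq> T \<inter> {z. f z = 0} \<and>
      m1.span (H n \<union> H (Suc n)) \<inter> f -` (s2 (\<pi> ^ n) ` f ` T) \<subseteq> s1 (\<pi> ^ n) ` T + m1.span Z" ..
  then obtain Z where "\<forall>n. finite (Z n) \<and> Z n \<subseteq> T \<inter> {z. f z = 0} \<and>
      m1.span (H n \<union> H (Suc n)) \<inter> f -` (s2 (\<pi> ^ n) ` f ` T) \<subseteq> s1 (\<pi> ^ n) ` T + m1.span (Z n)"
    by (rule exE[OF choice])
  then have Z: "\<And>n. finite (Z n)" "\<And>n. Z n \<subseteq> T" "\<And>n. Z n \<subseteq> {z. f z = 0}"
    "\<And>n. m1.span (H n \<union> H (Suc n)) \<inter> f -` (s2 (\<pi> ^ n) ` f ` T) \<subseteq> s1 (\<pi> ^ n) ` T + m1.span (Z n)"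
    by (simp_all only: Int_subset_iff)
  show ?thesis by (rule that[of H Z, OF H Z])
qed

end

section \<open>Extensions\<close>

locale complete_torsionfree_extension =
  K: complete_torsionfree_module sK \<pi> BK + L: complete_torsionfree_module sL \<pi> BL +
  P: complete_torsionfree_module sP \<pi> BP
  for sK :: "'a::idom \<Rightarrow> 'k::ab_group_add \<Rightarrow> 'k" and sL :: "'a \<Rightarrow> 'l::ab_group_add \<Rightarrow> 'l"
    and sP :: "'a \<Rightarrow> 'p::ab_group_add \<Rightarrow> 'p" and \<pi> :: 'a and BK BL BP +
  fixes f :: "'k \<Rightarrow> 'l" and g :: "'l \<Rightarrow> 'p"
  assumes extension: "born_extension sK BK sL BL sP BP f g"
    and dvr: "dvr_uniformiser \<pi>"
begin

lemma module_hom_f: "module_hom sK sL f"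
  and module_hom_g: "module_hom sL sP g"
  and f_bounded: "bounded_map BK BL f"
  and g_bounded: "bounded_map BL BP g"
  and inj_f: "inj f"
  and kernel_g: "g y = 0 \<longleftrightarrow> y \<in> range f"
  and surj_g: "surj g"
  and bounded_iff_image_bounded: "S \<in> BK \<longleftrightarrow> f ` S \<in> BL"
  and bounded_lift: "S' \<in> BP \<Longrightarrow> \<exists>T\<in>BL. S' = g ` T"
  using extension unfolding born_extension_def by auto

sublocale hf: module_hom sK sL f
  by (rule module_hom_f)

sublocale hg: dvr_module_hom sL sP g \<pi>
  by (rule dvr_module_hom.intro[OF module_hom_g]) (rule dvr_module_hom_axioms.intro[OF dvr])

lemma vimage_bounded: "T \<in> BL \<Longrightarrow> f -` T \<in> BK"
  unfolding bounded_iff_image_bounded by (erule L.bounded_subset) (rule image_vimage_subset)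

lemma scale_pow_vimage:
  assumes "f x \<in> sL (\<pi> ^ n) ` T"
  shows "x \<in> sK (\<pi> ^ n) ` (f -` T)"
proof -
  obtain t where "t \<in> T" and t: "f x = sL (\<pi> ^ n) t" using assms by blast
  have "sP (\<pi> ^ n) (g t) = g (f x)" unfolding t by (rule hg.scale[symmetric])
  also have "\<dots> = 0" using kernel_g by blast
  finally have "g t = 0" by (rule P.scale_pow_eq_zero[OF P.torsionfree P.pi_nonzero])
  then obtain k where k: "t = f k" using kernel_g by blast
  then have "f x = f (sK (\<pi> ^ n) k)" using t by (simp add: hf.scale)
  then have "x = sK (\<pi> ^ n) k" by (rule injD[OF inj_f])
  then show ?thesis using \<open>t \<in> T\<close> k by blast
qed

lemma span_inter_range_finitely_lifted:
  assumes "finite F" "F \<subseteq> T" and T: "L.subspace T"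
  obtains G where "finite G" "G \<subseteq> f -` T"
    "L.span F \<inter> (range f + sL (\<pi> ^ n) ` T) \<subseteq> f ` K.span G + sL (\<pi> ^ n) ` T"
proof -
  have Tn: "L.subspace (sL (\<pi> ^ n) ` T)" by (rule L.subspace_scale_image[OF T])
  define A where "A = L.span F \<inter> (range f + sL (\<pi> ^ n) ` T)"
  have "L.subspace A"
    unfolding A_def using hf.subspace_image[OF K.subspace_UNIV]
    by (intro L.subspace_inter L.subspace_span L.subspace_set_plus Tn)
  moreover have "A \<subseteq> L.span F" unfolding A_def by (rule Int_lower1)
  ultimately have "\<exists>E. finite E \<and> E \<subseteq> A \<and> A \<subseteq> L.span E"
    by (rule hg.source.finitely_generated_subspace[OF assms(1)])
  then obtain E where E: "finite E" "E \<subseteq> A" "A \<subseteq> L.span E" by blast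
  have "\<exists>k. e - f k \<in> sL (\<pi> ^ n) ` T" if "e \<in> E" for e
  proof -
    from that E(2) have "e \<in> range f + sL (\<pi> ^ n) ` T" unfolding A_def by blast
    then obtain k v where "v \<in> sL (\<pi> ^ n) ` T" "e = f k + v" by (auto elim!: set_plus_elim)
    then show ?thesis by (intro exI[of _ k]) simp
  qed
  then have "\<forall>e\<in>E. \<exists>k. e - f k \<in> sL (\<pi> ^ n) ` T" by blast
  then have "\<exists>kf. \<forall>e\<in>E. e - f (kf e) \<in> sL (\<pi> ^ n) ` T" by (rule bchoice)
  then obtain kf where kf: "\<forall>e\<in>E. e - f (kf e) \<in> sL (\<pi> ^ n) ` T" ..
  show ?thesis
  proof (rule that[of "kf ` E"])
    show "finite (kf ` E)" using E(1) by (rule finite_imageI)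
    show "kf ` E \<subseteq> f -` T"
    proof
      fix k assume "k \<in> kf ` E"
      then obtain e where "e \<in> E" "k = kf e" by blast
      then have "e \<in> T" "e - f k \<in> T"
        using E(2) L.span_minimal[OF assms(2) T] kf L.scale_image_subset[OF T] unfolding A_def by blast+
      then have "e - (e - f k) \<in> T" by (rule L.subspace_diff[OF T])
      then show "k \<in> f -` T" by simp
    qed
    have "e \<in> L.span (f ` kf ` E) + sL (\<pi> ^ n) ` T" if "e \<in> E" for e
    proof -
      have "f (kf e) \<in> L.span (f ` kf ` E)" using that by (intro L.span_base imageI)
      then have "f (kf e) + (e - f (kf e)) \<in> L.span (f ` kf ` E) + sL (\<pi> ^ n) ` T"
        using kf that by (intro set_plus_intro) auto
      then show ?thesis by simp
    qed
    then have "L.span E \<subseteq> L.span (f ` kf ` E) + sL (\<pi> ^ n) ` T"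
      by (intro L.span_minimal subsetI L.subspace_set_plus L.subspace_span Tn)
    with E(3) show "L.span F \<inter> (range f + sL (\<pi> ^ n) ` T) \<subseteq> f ` K.span (kf ` E) + sL (\<pi> ^ n) ` T"
      unfolding A_def by (simp add: hf.span_image)
  qed
qed

lemma vimage_span_plus_scale_pow:
  assumes "finite F" "F \<subseteq> T" and T: "L.subspace T"
  obtains G where "finite G" "G \<subseteq> f -` T"
    "f -` (L.span F + sL (\<pi> ^ n) ` T) \<subseteq> K.span G + sK (\<pi> ^ n) ` (f -` T)"
proof -
  have Tn: "L.subspace (sL (\<pi> ^ n) ` T)" by (rule L.subspace_scale_image[OF T])
  obtain G where G: "finite G" "G \<subseteq> f -` T"
    and approx: "L.span F \<inter> (range f + sL (\<pi> ^ n) ` T) \<subseteq> f ` K.span G + sL (\<pi> ^ n) ` T"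
    by (rule span_inter_range_finitely_lifted[OF assms])
  have "x \<in> K.span G + sK (\<pi> ^ n) ` (f -` T)" if x: "x \<in> f -` (L.span F + sL (\<pi> ^ n) ` T)" for x
  proof -
    obtain a v where a: "a \<in> L.span F" and v: "v \<in> sL (\<pi> ^ n) ` T" and "f x = a + v"
      using x by (auto elim!: set_plus_elim)
    have "- v \<in> sL (\<pi> ^ n) ` T" using v by (rule L.subspace_neg[OF Tn])
    then have "f x + - v \<in> range f + sL (\<pi> ^ n) ` T" by (intro set_plus_intro rangeI)
    with a \<open>f x = a + v\<close> have "a \<in> f ` K.span G + sL (\<pi> ^ n) ` T" by (intro subsetD[OF approx]) simp
    then obtain a' w where a': "a' \<in> f ` K.span G" and w: "w \<in> sL (\<pi> ^ n) ` T" and "a = a' + w"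
      by (elim set_plus_elim) simp
    from a' obtain k where k: "k \<in> K.span G" and "a' = f k" by blast
    then have "f (x - k) = w + v" using \<open>f x = a + v\<close> \<open>a = a' + w\<close> by (simp add: hf.diff)
    moreover have "w + v \<in> sL (\<pi> ^ n) ` T" using w v by (rule L.subspace_add[OF Tn])
    ultimately have "x - k \<in> sK (\<pi> ^ n) ` (f -` T)" by (intro scale_pow_vimage) simp
    then have "k + (x - k) \<in> K.span G + sK (\<pi> ^ n) ` (f -` T)" using k by (intro set_plus_intro)
    then show ?thesis by simp
  qed
  then have "f -` (L.span F + sL (\<pi> ^ n) ` T) \<subseteq> K.span G + sK (\<pi> ^ n) ` (f -` T)"
    by (rule subsetI)
  with G show ?thesis by (rule that)
qed

lemma compactoid_of_compactoid_image:
  assumes "compactoid sL \<pi> BL (f ` S)"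
  shows "compactoid sK \<pi> BK S"
proof -
  obtain T F where fS: "T \<in> BL" "L.subspace T" "f ` S \<subseteq> T" "\<And>n. finite (F n)" "\<And>n. F n \<subseteq> T"
    "\<And>n. f ` S \<subseteq> L.span (F n) + sL (\<pi> ^ n) ` T"
    using assms by (elim L.compactoidE) (rule that)
  have "\<exists>G. finite G \<and> G \<subseteq> f -` T \<and>
      f -` (L.span (F n) + sL (\<pi> ^ n) ` T) \<subseteq> K.span G + sK (\<pi> ^ n) ` (f -` T)" for n
  proof -
    obtain G where "finite G" "G \<subseteq> f -` T"
      "f -` (L.span (F n) + sL (\<pi> ^ n) ` T) \<subseteq> K.span G + sK (\<pi> ^ n) ` (f -` T)"
      by (rule vimage_span_plus_scale_pow[OF fS(4,5,2)])
    then show ?thesis by (intro exI[of _ G] conjI)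
  qed
  then have "\<forall>n. \<exists>G. finite G \<and> G \<subseteq> f -` T \<and>
      f -` (L.span (F n) + sL (\<pi> ^ n) ` T) \<subseteq> K.span G + sK (\<pi> ^ n) ` (f -` T)" ..
  then obtain G where G: "\<forall>n. finite (G n) \<and> G n \<subseteq> f -` T \<and>
      f -` (L.span (F n) + sL (\<pi> ^ n) ` T) \<subseteq> K.span (G n) + sK (\<pi> ^ n) ` (f -` T)"
    by (rule exE[OF choice])
  show ?thesis
  proof (rule K.compactoidI[OF vimage_bounded[OF fS(1)] hf.subspace_vimage[OF fS(2)], where F = G])
    show "S \<subseteq> f -` T" using fS(3) by blast
    show "finite (G n)" "G n \<subseteq> f -` T" for n using G by simp_all
    fix n
    have "S \<subseteq> f -` (f ` S)" by blast
    also have "\<dots> \<subseteq> f -` (L.span (F n) + sL (\<pi> ^ n) ` T)" using fS(6) by (rule vimage_mono)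
    also have "\<dots> \<subseteq> K.span (G n) + sK (\<pi> ^ n) ` (f -` T)" using G by simp
    finally show "S \<subseteq> K.span (G n) + sK (\<pi> ^ n) ` (f -` T)" .
  qed
qed

lemma compactoid_lift:
  assumes "compactoid sP \<pi> BP S"
  shows "\<exists>W. compactoid sL \<pi> BL W \<and> S = g ` W"
proof -
  obtain TP F where S: "TP \<in> BP" "P.subspace TP" "S \<subseteq> TP" "\<And>n. finite (F n)" "\<And>n. F n \<subseteq> TP"
    "\<And>n. S \<subseteq> P.span (F n) + sP (\<pi> ^ n) ` TP"
    using assms by (elim P.compactoidE) (rule that)
  obtain T0 where "T0 \<in> BL" "TP = g ` T0" using bounded_lift[OF S(1)] by blast
  obtain T where T: "T \<in> BL" "L.subspace T" "pi_adic_complete sL \<pi> T" "T0 \<subseteq> T"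
    using \<open>T0 \<in> BL\<close> by (rule L.bounded_in_complete_subspace)
  have TP_T: "TP \<subseteq> g ` T" using \<open>TP = g ` T0\<close> T(4) by blast
  have "g ` T \<in> BP" using g_bounded T(1) unfolding bounded_map_def by blast
  then obtain Q where Q: "Q \<in> BP" "P.subspace Q" "pi_adic_complete sP \<pi> Q" "g ` T \<subseteq> Q"
    by (rule P.bounded_in_complete_subspace)
  have FT: "F n \<subseteq> g ` T" for n using S(5) TP_T by (rule order_trans)
  obtain H Z where H: "\<And>n. finite (H n)" "\<And>n. H n \<subseteq> T" "\<And>n. F n = g ` H n"
    and Z: "\<And>n. finite (Z n)" "\<And>n. Z n \<subseteq> T" "\<And>n. Z n \<subseteq> {z. g z = 0}"
      "\<And>n. L.span (H n \<union> H (Suc n)) \<inter> g -` (sP (\<pi> ^ n) ` g ` T) \<subseteq> sL (\<pi> ^ n) ` T + L.span (Z n)"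
    using hg.finite_lifts_with_kernel_corrections[where F = F, OF T(2) S(4) FT] by blast
  have "S \<subseteq> P.span (g ` H n) + sP (\<pi> ^ n) ` g ` T" for n
  proof -
    have "P.span (F n) + sP (\<pi> ^ n) ` TP \<subseteq> P.span (g ` H n) + sP (\<pi> ^ n) ` g ` T"
      unfolding H(3) by (intro set_plus_mono2 order_refl image_mono TP_T)
    with S(6) show ?thesis by (rule order_trans)
  qed
  then show ?thesis
    by (rule hg.compactoid_lift_if_approximable[where H = H and Z = Z, OF T(1-3) Q(2-4) H(1,2) Z])
qed

lemma born_extension_compactoid_born:
  "born_extension sK (compactoid_born sK \<pi> BK) sL (compactoid_born sL \<pi> BL)
     sP (compactoid_born sP \<pi> BP) f g"
proof -
  have "compactoid sK \<pi> BK S \<longleftrightarrow> compactoid sL \<pi> BL (f ` S)" for S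
    using hf.compactoid_image[OF _ f_bounded] compactoid_of_compactoid_image by blast
  moreover have "compactoid sP \<pi> BP (g ` S)" if "compactoid sL \<pi> BL S" for S
    using that g_bounded by (rule hg.compactoid_image)
  ultimately show ?thesis
    using module_hom_f module_hom_g inj_f kernel_g surj_g compactoid_lift
    unfolding born_extension_def bounded_map_def compactoid_born_def by auto
qed

lemma nuclear_if_nuclear_sub_quotient:
  assumes K: "nuclear sK \<pi> BK" and P: "nuclear sP \<pi> BP"
  shows "nuclear sL \<pi> BL"
  unfolding nuclear_def
proof
  fix S assume "S \<in> BL"
  then have "g ` S \<in> BP" using g_bounded by (simp add: bounded_map_def)
  with P have "compactoid sP \<pi> BP (g ` S)" by (simp add: nuclear_def)
  then obtain W where W: "compactoid sL \<pi> BL W" "g ` S = g ` W" using compactoid_lift by blast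
  obtain M where M: "M \<in> BL" "L.subspace M" "S \<union> W \<subseteq> M"
    using L.bounded_in_subspace[OF L.bounded_Un[OF \<open>S \<in> BL\<close> L.compactoid_imp_bounded[OF W(1)]]] by blast
  from K have "compactoid sK \<pi> BK (f -` M)" using vimage_bounded[OF M(1)] by (simp add: nuclear_def)
  then have "compactoid sL \<pi> BL (f ` f -` M)" using f_bounded by (rule hf.compactoid_image)
  with W(1) have "compactoid sL \<pi> BL (W + f ` f -` M)" by (rule L.compactoid_set_plus)
  moreover have "S \<subseteq> W + f ` f -` M"
  proof
    fix x assume "x \<in> S"
    then obtain w where "w \<in> W" "g x = g w" using W(2) by blast
    then have "g (x - w) = 0" by (simp add: hg.diff)
    then have "x - w \<in> range f" by (simp add: kernel_g)
    moreover have "x - w \<in> M" using M \<open>x \<in> S\<close> \<open>w \<in> W\<close> by (intro L.subspace_diff) auto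
    ultimately have "x - w \<in> f ` f -` M" by auto
    with \<open>w \<in> W\<close> have "w + (x - w) \<in> W + f ` f -` M" by (rule set_plus_intro)
    then show "x \<in> W + f ` f -` M" by simp
  qed
  ultimately show "compactoid sL \<pi> BL S" by (rule L.compactoid_subset)
qed

lemma nuclear_iff: "nuclear sL \<pi> BL \<longleftrightarrow> nuclear sK \<pi> BK \<and> nuclear sP \<pi> BP"
proof (intro iffI conjI)
  assume L: "nuclear sL \<pi> BL"
  show "nuclear sK \<pi> BK"
    unfolding nuclear_def
  proof
    fix S assume "S \<in> BK"
    with L have "compactoid sL \<pi> BL (f ` S)" by (simp add: nuclear_def bounded_iff_image_bounded)
    then show "compactoid sK \<pi> BK S" by (rule compactoid_of_compactoid_image)
  qed
  show "nuclear sP \<pi> BP"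
    unfolding nuclear_def
  proof
    fix S assume "S \<in> BP"
    then obtain T where "T \<in> BL" "S = g ` T" using bounded_lift by blast
    with L show "compactoid sP \<pi> BP S" unfolding nuclear_def using hg.compactoid_image g_bounded by blast
  qed
qed (use nuclear_if_nuclear_sub_quotient in blast)

end

theorem proposition4p6:
  fixes \<pi> :: "'v::idom"
    and sK :: "'v \<Rightarrow> 'k::ab_group_add \<Rightarrow> 'k" and BK :: "'k set set"
    and sL :: "'v \<Rightarrow> 'l::ab_group_add \<Rightarrow> 'l" and BL :: "'l set set"
    and sP :: "'v \<Rightarrow> 'p::ab_group_add \<Rightarrow> 'p" and BP :: "'p set set"
    and f :: "'k \<Rightarrow> 'l" and g :: "'l \<Rightarrow> 'p"
  assumes V: "complete_dvr \<pi>"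
    and K: "complete_born_module sK \<pi> BK" "born_torsionfree sK \<pi> BK"
    and L: "complete_born_module sL \<pi> BL" "born_torsionfree sL \<pi> BL"
    and P: "complete_born_module sP \<pi> BP" "born_torsionfree sP \<pi> BP"
    and Palg: "alg_torsionfree sP"
    and ext: "born_extension sK BK sL BL sP BP f g"
  shows "complete_born_module sK \<pi> (compactoid_born sK \<pi> BK) \<and>
         complete_born_module sL \<pi> (compactoid_born sL \<pi> BL) \<and>
         complete_born_module sP \<pi> (compactoid_born sP \<pi> BP) \<and>
         born_extension sK (compactoid_born sK \<pi> BK) sL (compactoid_born sL \<pi> BL)
                        sP (compactoid_born sP \<pi> BP) f g \<and>
         (nuclear sL \<pi> BL \<longleftrightarrow> nuclear sK \<pi> BK \<and> nuclear sP \<pi> BP)"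
proof -
  have dvr: "dvr_uniformiser \<pi>" using V by (simp add: complete_dvr_def)
  then have "\<pi> \<noteq> 0" by (simp add: dvr_uniformiser_def)
  interpret complete_torsionfree_extension sK sL sP \<pi> BK BL BP f g
    by (rule complete_torsionfree_extension.intro[OF complete_torsionfree_moduleI[OF K \<open>\<pi> \<noteq> 0\<close>]
          complete_torsionfree_moduleI[OF L \<open>\<pi> \<noteq> 0\<close>] complete_torsionfree_moduleI[OF P \<open>\<pi> \<noteq> 0\<close>]])
      (rule complete_torsionfree_extension_axioms.intro[OF ext dvr])
  show ?thesis
    using K.complete_compactoid_born L.complete_compactoid_born P.complete_compactoid_born
      born_extension_compactoid_born nuclear_iff by blast
qed

end
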